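(* (Consistency) Let $e$ be a source expression, $A$ a source type and $M, M'$ target expressions. If $\emptyset \vdash e :: A \hookrightarrow M$ and $M \longrightarrow M'$, then there exists a source expression $e'$ such that $e \longrightarrow^{*} e'$ and $\emptyset \vdash e' :: A \hookrightarrow M'$.
   Context: **Source language.** Values $v ::= c \mid x \mid \lambda x.e$; expressions $e ::= v \mid \mathtt{let}\ x = e_1\ \mathtt{in}\ e_2 \mid \mathtt{if}\ e\ \mathtt{then}\ e_1\ \mathtt{else}\ e_2 \mid e_1\, e_2$. Here $c$ ranges over primitive constants (numbers, the booleans $\mathtt{true},\mathtt{false}$, operators such as $+,-$). Source types $A,B ::= b \mid A\to B \mid A\wedge B \mid A\vee B$ with primitive types $b ::= \mathtt{number} \mid \mathtt{boolean}$. Each constant $c$ has a type $\mathrm{ty}(c)$. Source evaluation contexts: $E ::= [\,] \mid \mathtt{let}\ x = E\ \mathtt{in}\ e \mid \mathtt{if}\ E\ \mathtt{then}\ e_1\ \mathtt{else}\ e_2 \mid E\, e \mid v\, E$. Source small-step relation $\longrightarrow$: if $e \longrightarrow e'$ then $E[e]\longrightarrow E[e']$; $c\, v \longrightarrow [\![c]\!](v)$ (where $[\![c]\!]$ is the partial function interpreting $c$; no step where it is undefined); $(\lambda x.e)\,v \longrightarrow [v/x]e$; $\mathtt{if}\ \mathtt{true}\ \mathtt{then}\ e_1\ \mathtt{else}\ e_2 \longrightarrow e_1$; $\mathtt{if}\ \mathtt{false}\ \mathtt{then}\ e_1\ \mathtt{else}\ e_2 \longrightarrow e_2$; $\mathtt{let}\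 x=v\ \mathtt{in}\ e \longrightarrow [v/x]e$. **Tags and well-formed types.** $\mathrm{tag}(\mathtt{number})=\{\text{"number"}\}$, $\mathrm{tag}(\mathtt{boolean})=\{\text{"boolean"}\}$, $\mathrm{tag}(A\to B)=\{\text{"function"}\}$, $\mathrm{tag}(A\wedge B)=\mathrm{tag}(A)$, $\mathrm{tag}(A\vee B)=\mathrm{tag}(A)\cup\mathrm{tag}(B)$. Well-formedness $\vdash A$: $\vdash b$ always; $\vdash A\to B$ iff $\vdash A$ and $\vdash B$; $\vdash A\wedge B$ iff $\vdash A$, $\vdash B$ and $\mathrm{tag}(A)=\mathrm{tag}(B)$; $\vdash A\vee B$ iff $\vdash A$, $\vdash B$ and $\mathrm{tag}(A)\cap\mathrm{tag}(B)=\emptyset$. **Target language.** Expressions $M ::= c \mid x \mid \lambda x.M \mid \mathtt{let}\ x=M_1\ \mathtt{in}\ M_2 \mid \mathtt{if}\ M\ \mathtt{then}\ M_1\ \mathtt{else}\ M_2 \mid M_1\,M_2 \mid \langle M_1,M_2\rangle \mid \mathrm{proj}_k M \mid \mathrm{inj}_1 M \mid \mathrm{inj}_2 M \mid \mathtt{case}\ M\ \mathtt{of}\ \mathrm{inj}_1 x_1\Rightarrow M_1 \mid \mathrm{inj}_2 x_2 \Rightarrow M_2 \mid \mathrm{DEAD}_{A\downarrow B}(M)$, where $A,B$ are source types and $k\in\{1,2\}$. Target values $W ::= c \mid x \mid \lambda x.M \mid \mathrm{inj}_1 W \mid \mathrm{inj}_2 W \mid \langle M_1,M_2\rangle \mid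 \mathrm{DEAD}_{A\downarrow B}(W)$ (pair components are arbitrary expressions). Target evaluation contexts: $F ::= [\,] \mid \mathtt{let}\ x = F\ \mathtt{in}\ M \mid \mathtt{if}\ F\ \mathtt{then}\ M_1\ \mathtt{else}\ M_2 \mid F\,M \mid W\,F \mid \mathrm{inj}_k F \mid \mathrm{proj}_k F \mid \mathrm{DEAD}_{A\downarrow B}(F) \mid \mathtt{case}\ F\ \mathtt{of}\ \mathrm{inj}_1 x_1\Rightarrow M_1 \mid \mathrm{inj}_2 x_2\Rightarrow M_2$. Target small-step relation $\longrightarrow$: if $M\longrightarrow M'$ then $F[M]\longrightarrow F[M']$; $c\,W\longrightarrow [\![c]\!](W)$ provided $W$ is not of the form $\mathrm{DEAD}_{A\downarrow B}(W')$; $(\lambda x.M)\,W\longrightarrow [W/x]M$; $\mathtt{if}\ \mathtt{true}$/$\mathtt{if}\ \mathtt{false}$ step to the first/second branch; $\mathtt{let}\ x=W\ \mathtt{in}\ M\longrightarrow [W/x]M$; $\mathrm{proj}_k\langle M_1,M_2\rangle\longrightarrow M_k$; $\mathtt{case}\ \mathrm{inj}_k W\ \mathtt{of}\ \mathrm{inj}_1 x_1\Rightarrow M_1\mid \mathrm{inj}_2 x_2\Rightarrow M_2 \longrightarrow [W/x_k]M_k$. In both languages $\longrightarrow^{*}$ is the reflexive transitive closure of $\longrightarrow$ and $\longrightarrow^{+}$ its transitive closure. **Elaboration judgment** $\Gamma\vdash e::A\hookrightarrow M$, where $\Gamma$ is a list of bindings $x:A$ ($\emptyset$ is the empty one), is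 inductively defined by: - (Const) $\Gamma\vdash c::\mathrm{ty}(c)\hookrightarrow c$. - (Var) if $x:A\in\Gamma$ then $\Gamma\vdash x::A\hookrightarrow x$. - (Let) if $\Gamma\vdash e_1::A_1\hookrightarrow M_1$ and $\Gamma,x:A_1\vdash e_2::A_2\hookrightarrow M_2$ then $\Gamma\vdash \mathtt{let}\ x=e_1\ \mathtt{in}\ e_2::A_2\hookrightarrow \mathtt{let}\ x=M_1\ \mathtt{in}\ M_2$. - (If) if $\Gamma\vdash e::\mathtt{boolean}\hookrightarrow M$ and $\Gamma\vdash e_i::A\hookrightarrow M_i$ for $i=1,2$ then $\Gamma\vdash \mathtt{if}\ e\ \mathtt{then}\ e_1\ \mathtt{else}\ e_2::A\hookrightarrow \mathtt{if}\ M\ \mathtt{then}\ M_1\ \mathtt{else}\ M_2$. - ($\wedge$I) if $\Gamma\vdash v::A_k\hookrightarrow M_k$ for $k=1,2$ ($v$ a value) and $\vdash A_1\wedge A_2$ then $\Gamma\vdash v::A_1\wedge A_2\hookrightarrow\langle M_1,M_2\rangle$. - ($\wedge$E) if $\Gamma\vdash e::A_1\wedge A_2\hookrightarrow M$ then $\Gamma\vdash e::A_k\hookrightarrow\mathrm{proj}_k M$ for $k\in\{1,2\}$. - (Lam) if $\vdash A\to B$ and $\Gamma,x:A\vdash e::B\hookrightarrow M$ then $\Gamma\vdash\lambda x.e::A\to B\hookrightarrow\lambda x.M$. - (App) if $\Gamma\vdash e_1::A\to B\hookrightarrow M_1$ and $\Gamma\vdash e_2::A\hookrightarrow M_2$ then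 $\Gamma\vdash e_1\,e_2::B\hookrightarrow M_1\,M_2$. - (Dead) if $\Gamma\vdash e::A\hookrightarrow M$ and $\mathrm{tag}(A)\cap\mathrm{tag}(B)=\emptyset$ then $\Gamma\vdash e::B\hookrightarrow\mathrm{DEAD}_{A\downarrow B}(M)$. - ($\vee$I) if $\Gamma\vdash e::A_k\hookrightarrow M$ and $\vdash A_1\vee A_2$ then $\Gamma\vdash e::A_1\vee A_2\hookrightarrow\mathrm{inj}_k M$. - ($\vee$E) for a source evaluation context $E$ (and $x_1,x_2$ occurring only in the hole), if $\Gamma\vdash e_0::A_1\vee A_2\hookrightarrow M_0$, $\Gamma,x_1:A_1\vdash E[x_1]::B\hookrightarrow M_1$ and $\Gamma,x_2:A_2\vdash E[x_2]::B\hookrightarrow M_2$ then $\Gamma\vdash E[e_0]::B\hookrightarrow \mathtt{case}\ M_0\ \mathtt{of}\ \mathrm{inj}_1x_1\Rightarrow M_1\mid\mathrm{inj}_2x_2\Rightarrow M_2$. **Standing assumption (primitive constant application).** If $\emptyset\vdash c::A\to B\hookrightarrow c$, $\emptyset\vdash v::A\hookrightarrow W$, and $W$ is not of the form $\mathrm{DEAD}_{C\downarrow A}(M)$, then $c\,v\longrightarrow[\![c]\!](v)$, $c\,W\longrightarrow[\![c]\!](W)$, and $\emptyset\vdash[\![c]\!](v)::B\hookrightarrow[\![c]\!](W)$. Primitive constants are defined on all values of their input domain but not on DEAD-cast values; a source primitive application gets stuck iff the elaborated argument is a DEAD-cast. *)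

theory Defs
  imports Main
begin

text \<open>
  Binders are represented by de Bruijn indices, so expressions are identified up to
  renaming of bound variables. A typing context is the list of the types of the
  variables, innermost first.
\<close>

section \<open>Types\<close>

datatype prim = Number | Boolean

datatype ty = Prim prim | Arrow ty ty | And ty ty | Or ty ty

primrec tag :: "ty \<Rightarrow> string set" where
  "tag (Prim b) = (case b of Number \<Rightarrow> {''number''} | Boolean \<Rightarrow> {''boolean''})"
| "tag (Arrow A B) = {''function''}"
| "tag (And A B) = tag A"
| "tag (Or A B) = tag A \<union> tag B"

primrec wf_ty :: "ty \<Rightarrow> bool" where
  "wf_ty (Prim b) \<longleftrightarrow> True"
| "wf_ty (Arrow A B) \<longleftrightarrow> wf_ty A \<and> wf_ty B"
| "wf_ty (And A B) \<longleftrightarrow> wf_ty A \<and> wf_ty B \<and> tag A = tag B"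
| "wf_ty (Or A B) \<longleftrightarrow> wf_ty A \<and> wf_ty B \<and> tag A \<inter> tag B = {}"

section \<open>Primitive constants\<close>

text \<open>
  The type \<open>'n\<close> of numerals and the type \<open>'o\<close> of operators are parameters, and so is the
  typing \<open>opty\<close> of the operators.
\<close>

datatype ('n, 'o) const = Num 'n | Bool bool | Op 'o

primrec const_ty :: "('o \<Rightarrow> ty) \<Rightarrow> ('n, 'o) const \<Rightarrow> ty" where
  "const_ty opty (Num n) = Prim Number"
| "const_ty opty (Bool b) = Prim Boolean"
| "const_ty opty (Op f) = opty f"

text \<open>Lifting of a renaming under a binder; used for both languages.\<close>

definition up_ren :: "(nat \<Rightarrow> nat) \<Rightarrow> nat \<Rightarrow> nat" where
  "up_ren r = case_nat 0 (\<lambda>i. Suc (r i))"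

section \<open>Source language\<close>

datatype ('n, 'o) sexp =
    SConst "('n, 'o) const"
  | SVar nat
  | SLam "('n, 'o) sexp"
  | SLet "('n, 'o) sexp" "('n, 'o) sexp"
  | SIf "('n, 'o) sexp" "('n, 'o) sexp" "('n, 'o) sexp"
  | SApp "('n, 'o) sexp" "('n, 'o) sexp"

primrec is_sval :: "('n, 'o) sexp \<Rightarrow> bool" where
  "is_sval (SConst c) \<longleftrightarrow> True"
| "is_sval (SVar i) \<longleftrightarrow> True"
| "is_sval (SLam e) \<longleftrightarrow> True"
| "is_sval (SLet e1 e2) \<longleftrightarrow> False"
| "is_sval (SIf e e1 e2) \<longleftrightarrow> False"
| "is_sval (SApp e1 e2) \<longleftrightarrow> False"

primrec sren :: "(nat \<Rightarrow> nat) \<Rightarrow> ('n, 'o) sexp \<Rightarrow> ('n, 'o) sexp" where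
  "sren r (SConst c) = SConst c"
| "sren r (SVar i) = SVar (r i)"
| "sren r (SLam e) = SLam (sren (up_ren r) e)"
| "sren r (SLet e1 e2) = SLet (sren r e1) (sren (up_ren r) e2)"
| "sren r (SIf e e1 e2) = SIf (sren r e) (sren r e1) (sren r e2)"
| "sren r (SApp e1 e2) = SApp (sren r e1) (sren r e2)"

definition up_ssub :: "(nat \<Rightarrow> ('n, 'o) sexp) \<Rightarrow> nat \<Rightarrow> ('n, 'o) sexp" where
  "up_ssub s = case_nat (SVar 0) (\<lambda>i. sren Suc (s i))"

primrec ssub :: "(nat \<Rightarrow> ('n, 'o) sexp) \<Rightarrow> ('n, 'o) sexp \<Rightarrow> ('n, 'o) sexp" where
  "ssub s (SConst c) = SConst c"
| "ssub s (SVar i) = s i"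
| "ssub s (SLam e) = SLam (ssub (up_ssub s) e)"
| "ssub s (SLet e1 e2) = SLet (ssub s e1) (ssub (up_ssub s) e2)"
| "ssub s (SIf e e1 e2) = SIf (ssub s e) (ssub s e1) (ssub s e2)"
| "ssub s (SApp e1 e2) = SApp (ssub s e1) (ssub s e2)"

text \<open>\<open>ssub1 v e\<close> is \<open>[v/x]e\<close> where \<open>x\<close> is the outermost bound variable, index \<open>0\<close>, of \<open>e\<close>.\<close>

definition ssub1 :: "('n, 'o) sexp \<Rightarrow> ('n, 'o) sexp \<Rightarrow> ('n, 'o) sexp" where
  "ssub1 v e = ssub (case_nat v SVar) e"

datatype ('n, 'o) sctx =
    SHole
  | SCLet "('n, 'o) sctx" "('n, 'o) sexp"
  | SCIf "('n, 'o) sctx" "('n, 'o) sexp" "('n, 'o) sexp"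
  | SCAppL "('n, 'o) sctx" "('n, 'o) sexp"
  | SCAppR "('n, 'o) sexp" "('n, 'o) sctx"

primrec is_sctx :: "('n, 'o) sctx \<Rightarrow> bool" where
  "is_sctx SHole \<longleftrightarrow> True"
| "is_sctx (SCLet E e) \<longleftrightarrow> is_sctx E"
| "is_sctx (SCIf E e1 e2) \<longleftrightarrow> is_sctx E"
| "is_sctx (SCAppL E e) \<longleftrightarrow> is_sctx E"
| "is_sctx (SCAppR v E) \<longleftrightarrow> is_sval v \<and> is_sctx E"

text \<open>The hole of an evaluation context is never under a binder, so filling needs no lifting.\<close>

primrec splug :: "('n, 'o) sctx \<Rightarrow> ('n, 'o) sexp \<Rightarrow> ('n, 'o) sexp" where
  "splug SHole e0 = e0"
| "splug (SCLet E e) e0 = SLet (splug E e0) e"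
| "splug (SCIf E e1 e2) e0 = SIf (splug E e0) e1 e2"
| "splug (SCAppL E e) e0 = SApp (splug E e0) e"
| "splug (SCAppR v E) e0 = SApp v (splug E e0)"

primrec sctx_ren :: "(nat \<Rightarrow> nat) \<Rightarrow> ('n, 'o) sctx \<Rightarrow> ('n, 'o) sctx" where
  "sctx_ren r SHole = SHole"
| "sctx_ren r (SCLet E e) = SCLet (sctx_ren r E) (sren (up_ren r) e)"
| "sctx_ren r (SCIf E e1 e2) = SCIf (sctx_ren r E) (sren r e1) (sren r e2)"
| "sctx_ren r (SCAppL E e) = SCAppL (sctx_ren r E) (sren r e)"
| "sctx_ren r (SCAppR v E) = SCAppR (sren r v) (sctx_ren r E)"

text \<open>The parameter \<open>\<delta>\<close> is the partial interpretation of the constants on source values.\<close>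

inductive sstep :: "(('n, 'o) const \<Rightarrow> ('n, 'o) sexp \<rightharpoonup> ('n, 'o) sexp) \<Rightarrow>
    ('n, 'o) sexp \<Rightarrow> ('n, 'o) sexp \<Rightarrow> bool" for \<delta> where
  sstep_ctx: "is_sctx E \<Longrightarrow> sstep \<delta> e e' \<Longrightarrow> sstep \<delta> (splug E e) (splug E e')"
| sstep_prim: "is_sval v \<Longrightarrow> \<delta> c v = Some e \<Longrightarrow> sstep \<delta> (SApp (SConst c) v) e"
| sstep_beta: "is_sval v \<Longrightarrow> sstep \<delta> (SApp (SLam e) v) (ssub1 v e)"
| sstep_if_true: "sstep \<delta> (SIf (SConst (Bool True)) e1 e2) e1"
| sstep_if_false: "sstep \<delta> (SIf (SConst (Bool False)) e1 e2) e2"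
| sstep_let: "is_sval v \<Longrightarrow> sstep \<delta> (SLet v e) (ssub1 v e)"

section \<open>Target language\<close>

text \<open>
  \<open>TDead A B M\<close> is the cast written DEAD with subscript \<open>A\<down>B\<close>. In \<open>TCase M M1 M2\<close>, index \<open>0\<close> is
  bound in each of \<open>M1\<close> and \<open>M2\<close>.
\<close>

datatype ('n, 'o) texp =
    TConst "('n, 'o) const"
  | TVar nat
  | TLam "('n, 'o) texp"
  | TLet "('n, 'o) texp" "('n, 'o) texp"
  | TIf "('n, 'o) texp" "('n, 'o) texp" "('n, 'o) texp"
  | TApp "('n, 'o) texp" "('n, 'o) texp"
  | TPair "('n, 'o) texp" "('n, 'o) texp"
  | TProj1 "('n, 'o) texp"
  | TProj2 "('n, 'o) texp"
  | TInj1 "('n, 'o) texp"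
  | TInj2 "('n, 'o) texp"
  | TCase "('n, 'o) texp" "('n, 'o) texp" "('n, 'o) texp"
  | TDead ty ty "('n, 'o) texp"

primrec is_tval :: "('n, 'o) texp \<Rightarrow> bool" where
  "is_tval (TConst c) \<longleftrightarrow> True"
| "is_tval (TVar i) \<longleftrightarrow> True"
| "is_tval (TLam M) \<longleftrightarrow> True"
| "is_tval (TLet M1 M2) \<longleftrightarrow> False"
| "is_tval (TIf M M1 M2) \<longleftrightarrow> False"
| "is_tval (TApp M1 M2) \<longleftrightarrow> False"
| "is_tval (TPair M1 M2) \<longleftrightarrow> True"
| "is_tval (TProj1 M) \<longleftrightarrow> False"
| "is_tval (TProj2 M) \<longleftrightarrow> False"
| "is_tval (TInj1 M) \<longleftrightarrow> is_tval M"
| "is_tval (TInj2 M) \<longleftrightarrow> is_tval M"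
| "is_tval (TCase M M1 M2) \<longleftrightarrow> False"
| "is_tval (TDead A B M) \<longleftrightarrow> is_tval M"

primrec tren :: "(nat \<Rightarrow> nat) \<Rightarrow> ('n, 'o) texp \<Rightarrow> ('n, 'o) texp" where
  "tren r (TConst c) = TConst c"
| "tren r (TVar i) = TVar (r i)"
| "tren r (TLam M) = TLam (tren (up_ren r) M)"
| "tren r (TLet M1 M2) = TLet (tren r M1) (tren (up_ren r) M2)"
| "tren r (TIf M M1 M2) = TIf (tren r M) (tren r M1) (tren r M2)"
| "tren r (TApp M1 M2) = TApp (tren r M1) (tren r M2)"
| "tren r (TPair M1 M2) = TPair (tren r M1) (tren r M2)"
| "tren r (TProj1 M) = TProj1 (tren r M)"
| "tren r (TProj2 M) = TProj2 (tren r M)"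
| "tren r (TInj1 M) = TInj1 (tren r M)"
| "tren r (TInj2 M) = TInj2 (tren r M)"
| "tren r (TCase M M1 M2) = TCase (tren r M) (tren (up_ren r) M1) (tren (up_ren r) M2)"
| "tren r (TDead A B M) = TDead A B (tren r M)"

definition up_tsub :: "(nat \<Rightarrow> ('n, 'o) texp) \<Rightarrow> nat \<Rightarrow> ('n, 'o) texp" where
  "up_tsub s = case_nat (TVar 0) (\<lambda>i. tren Suc (s i))"

primrec tsub :: "(nat \<Rightarrow> ('n, 'o) texp) \<Rightarrow> ('n, 'o) texp \<Rightarrow> ('n, 'o) texp" where
  "tsub s (TConst c) = TConst c"
| "tsub s (TVar i) = s i"
| "tsub s (TLam M) = TLam (tsub (up_tsub s) M)"
| "tsub s (TLet M1 M2) = TLet (tsub s M1) (tsub (up_tsub s) M2)"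
| "tsub s (TIf M M1 M2) = TIf (tsub s M) (tsub s M1) (tsub s M2)"
| "tsub s (TApp M1 M2) = TApp (tsub s M1) (tsub s M2)"
| "tsub s (TPair M1 M2) = TPair (tsub s M1) (tsub s M2)"
| "tsub s (TProj1 M) = TProj1 (tsub s M)"
| "tsub s (TProj2 M) = TProj2 (tsub s M)"
| "tsub s (TInj1 M) = TInj1 (tsub s M)"
| "tsub s (TInj2 M) = TInj2 (tsub s M)"
| "tsub s (TCase M M1 M2) = TCase (tsub s M) (tsub (up_tsub s) M1) (tsub (up_tsub s) M2)"
| "tsub s (TDead A B M) = TDead A B (tsub s M)"

definition tsub1 :: "('n, 'o) texp \<Rightarrow> ('n, 'o) texp \<Rightarrow> ('n, 'o) texp" where
  "tsub1 W M = tsub (case_nat W TVar) M"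

datatype ('n, 'o) tctx =
    THole
  | TCLet "('n, 'o) tctx" "('n, 'o) texp"
  | TCIf "('n, 'o) tctx" "('n, 'o) texp" "('n, 'o) texp"
  | TCAppL "('n, 'o) tctx" "('n, 'o) texp"
  | TCAppR "('n, 'o) texp" "('n, 'o) tctx"
  | TCInj1 "('n, 'o) tctx"
  | TCInj2 "('n, 'o) tctx"
  | TCProj1 "('n, 'o) tctx"
  | TCProj2 "('n, 'o) tctx"
  | TCDead ty ty "('n, 'o) tctx"
  | TCCase "('n, 'o) tctx" "('n, 'o) texp" "('n, 'o) texp"

primrec is_tctx :: "('n, 'o) tctx \<Rightarrow> bool" where
  "is_tctx THole \<longleftrightarrow> True"
| "is_tctx (TCLet F M) \<longleftrightarrow> is_tctx F"
| "is_tctx (TCIf F M1 M2) \<longleftrightarrow> is_tctx F"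
| "is_tctx (TCAppL F M) \<longleftrightarrow> is_tctx F"
| "is_tctx (TCAppR W F) \<longleftrightarrow> is_tval W \<and> is_tctx F"
| "is_tctx (TCInj1 F) \<longleftrightarrow> is_tctx F"
| "is_tctx (TCInj2 F) \<longleftrightarrow> is_tctx F"
| "is_tctx (TCProj1 F) \<longleftrightarrow> is_tctx F"
| "is_tctx (TCProj2 F) \<longleftrightarrow> is_tctx F"
| "is_tctx (TCDead A B F) \<longleftrightarrow> is_tctx F"
| "is_tctx (TCCase F M1 M2) \<longleftrightarrow> is_tctx F"

primrec tplug :: "('n, 'o) tctx \<Rightarrow> ('n, 'o) texp \<Rightarrow> ('n, 'o) texp" where
  "tplug THole M0 = M0"
| "tplug (TCLet F M) M0 = TLet (tplug F M0) M"
| "tplug (TCIf F M1 M2) M0 = TIf (tplug F M0) M1 M2"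
| "tplug (TCAppL F M) M0 = TApp (tplug F M0) M"
| "tplug (TCAppR W F) M0 = TApp W (tplug F M0)"
| "tplug (TCInj1 F) M0 = TInj1 (tplug F M0)"
| "tplug (TCInj2 F) M0 = TInj2 (tplug F M0)"
| "tplug (TCProj1 F) M0 = TProj1 (tplug F M0)"
| "tplug (TCProj2 F) M0 = TProj2 (tplug F M0)"
| "tplug (TCDead A B F) M0 = TDead A B (tplug F M0)"
| "tplug (TCCase F M1 M2) M0 = TCase (tplug F M0) M1 M2"

inductive tstep :: "(('n, 'o) const \<Rightarrow> ('n, 'o) texp \<rightharpoonup> ('n, 'o) texp) \<Rightarrow>
    ('n, 'o) texp \<Rightarrow> ('n, 'o) texp \<Rightarrow> bool" for \<delta> where
  tstep_ctx: "is_tctx F \<Longrightarrow> tstep \<delta> M M' \<Longrightarrow> tstep \<delta> (tplug F M) (tplug F M')"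
| tstep_prim: "is_tval W \<Longrightarrow> \<nexists>A B W'. W = TDead A B W' \<Longrightarrow> \<delta> c W = Some M \<Longrightarrow>
    tstep \<delta> (TApp (TConst c) W) M"
| tstep_beta: "is_tval W \<Longrightarrow> tstep \<delta> (TApp (TLam M) W) (tsub1 W M)"
| tstep_if_true: "tstep \<delta> (TIf (TConst (Bool True)) M1 M2) M1"
| tstep_if_false: "tstep \<delta> (TIf (TConst (Bool False)) M1 M2) M2"
| tstep_let: "is_tval W \<Longrightarrow> tstep \<delta> (TLet W M) (tsub1 W M)"
| tstep_proj1: "tstep \<delta> (TProj1 (TPair M1 M2)) M1"
| tstep_proj2: "tstep \<delta> (TProj2 (TPair M1 M2)) M2"
| tstep_case1: "is_tval W \<Longrightarrow> tstep \<delta> (TCase (TInj1 W) M1 M2) (tsub1 W M1)"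
| tstep_case2: "is_tval W \<Longrightarrow> tstep \<delta> (TCase (TInj2 W) M1 M2) (tsub1 W M2)"

section \<open>Elaboration\<close>

text \<open>
  In rule \<open>elab_OrE\<close> the context \<open>E\<close> is lifted over the new variable, which therefore occurs
  only in the hole.
\<close>

inductive elab :: "('o \<Rightarrow> ty) \<Rightarrow> ty list \<Rightarrow> ('n, 'o) sexp \<Rightarrow> ty \<Rightarrow> ('n, 'o) texp \<Rightarrow> bool"
  for opty where
  elab_Const: "elab opty \<Gamma> (SConst c) (const_ty opty c) (TConst c)"
| elab_Var: "i < length \<Gamma> \<Longrightarrow> \<Gamma> ! i = A \<Longrightarrow> elab opty \<Gamma> (SVar i) A (TVar i)"
| elab_Let: "elab opty \<Gamma> e1 A1 M1 \<Longrightarrow> elab opty (A1 # \<Gamma>) e2 A2 M2 \<Longrightarrow>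
    elab opty \<Gamma> (SLet e1 e2) A2 (TLet M1 M2)"
| elab_If: "elab opty \<Gamma> e (Prim Boolean) M \<Longrightarrow> elab opty \<Gamma> e1 A M1 \<Longrightarrow> elab opty \<Gamma> e2 A M2 \<Longrightarrow>
    elab opty \<Gamma> (SIf e e1 e2) A (TIf M M1 M2)"
| elab_AndI: "is_sval v \<Longrightarrow> elab opty \<Gamma> v A1 M1 \<Longrightarrow> elab opty \<Gamma> v A2 M2 \<Longrightarrow> wf_ty (And A1 A2) \<Longrightarrow>
    elab opty \<Gamma> v (And A1 A2) (TPair M1 M2)"
| elab_AndE1: "elab opty \<Gamma> e (And A1 A2) M \<Longrightarrow> elab opty \<Gamma> e A1 (TProj1 M)"
| elab_AndE2: "elab opty \<Gamma> e (And A1 A2) M \<Longrightarrow> elab opty \<Gamma> e A2 (TProj2 M)"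
| elab_Lam: "wf_ty (Arrow A B) \<Longrightarrow> elab opty (A # \<Gamma>) e B M \<Longrightarrow>
    elab opty \<Gamma> (SLam e) (Arrow A B) (TLam M)"
| elab_App: "elab opty \<Gamma> e1 (Arrow A B) M1 \<Longrightarrow> elab opty \<Gamma> e2 A M2 \<Longrightarrow>
    elab opty \<Gamma> (SApp e1 e2) B (TApp M1 M2)"
| elab_Dead: "elab opty \<Gamma> e A M \<Longrightarrow> tag A \<inter> tag B = {} \<Longrightarrow> elab opty \<Gamma> e B (TDead A B M)"
| elab_OrI1: "elab opty \<Gamma> e A1 M \<Longrightarrow> wf_ty (Or A1 A2) \<Longrightarrow> elab opty \<Gamma> e (Or A1 A2) (TInj1 M)"
| elab_OrI2: "elab opty \<Gamma> e A2 M \<Longrightarrow> wf_ty (Or A1 A2) \<Longrightarrow> elab opty \<Gamma> e (Or A1 A2) (TInj2 M)"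
| elab_OrE: "is_sctx E \<Longrightarrow> elab opty \<Gamma> e0 (Or A1 A2) M0 \<Longrightarrow>
    elab opty (A1 # \<Gamma>) (splug (sctx_ren Suc E) (SVar 0)) B M1 \<Longrightarrow>
    elab opty (A2 # \<Gamma>) (splug (sctx_ren Suc E) (SVar 0)) B M2 \<Longrightarrow>
    elab opty \<Gamma> (splug E e0) B (TCase M0 M1 M2)"

section \<open>Assumption on primitive application\<close>

text \<open>
  \<open>\<delta>s\<close> and \<open>\<delta>t\<close> interpret the constants on source and on target values. An application of a
  constant to a source value whose elaboration is a DEAD cast is deliberately not required to be
  stuck: \<open>Num n\<close> elaborates at type \<open>Prim Number\<close> both to \<open>TConst (Num n)\<close> and, by two uses of
  \<open>elab_Dead\<close>, to a DEAD cast, so such a requirement would contradict \<open>prim_app\<close> as soon as some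
  operator accepts numbers.
\<close>

definition prim_app :: "('o \<Rightarrow> ty) \<Rightarrow>
    (('n, 'o) const \<Rightarrow> ('n, 'o) sexp \<rightharpoonup> ('n, 'o) sexp) \<Rightarrow>
    (('n, 'o) const \<Rightarrow> ('n, 'o) texp \<rightharpoonup> ('n, 'o) texp) \<Rightarrow> bool" where
  "prim_app opty \<delta>s \<delta>t \<longleftrightarrow>
    (\<forall>c v W A B. is_sval v \<longrightarrow> is_tval W \<longrightarrow>
      elab opty [] (SConst c :: ('n, 'o) sexp) (Arrow A B) (TConst c) \<longrightarrow>
      elab opty [] v A W \<longrightarrow> (\<nexists>C M. W = TDead C A M) \<longrightarrow>
      (\<exists>e M. \<delta>s c v = Some e \<and> \<delta>t c W = Some M \<and>
        sstep \<delta>s (SApp (SConst c) v) e \<and> tstep \<delta>t (TApp (TConst c) W) M \<and>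
        elab opty [] e B M)) \<and>
    (\<forall>c A B W. is_tval W \<longrightarrow> \<delta>t c (TDead A B W) = None)"

end

theory Submission
  imports Defs
begin

text \<open>
  The elaboration judgment has exactly one rule for each target constructor, so it can be inverted
  along the target expression. In particular only source values elaborate to target values: the
  rules whose target may be a value either require a source value or keep the source expression.
  Hence a target redex that fires on a value corresponds to a source redex on a value or, for
  projections and \<open>case\<close>, to no source step at all, and it remains to substitute values for
  variables in an elaboration. A step inside a target context is followed by the steps that
  induction yields for the subexpression, because the frames are elaborated from source frames or
  leave the source expression unchanged.
\<close>

section \<open>Renaming and substitution in source expressions\<close>

lemma up_ren_Suc: "up_ren r \<circ> Suc = Suc \<circ> r"
  by (auto simp: up_ren_def)

lemma up_ren_comp: "up_ren r \<circ> up_ren q = up_ren (r \<circ> q)"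
  by (auto simp: up_ren_def fun_eq_iff split: nat.split)

lemma sren_sren: "sren r (sren q e) = sren (r \<circ> q) e"
  by (induction e arbitrary: r q) (simp_all add: up_ren_comp)

lemma up_ssub_up_ren: "up_ssub s \<circ> up_ren r = up_ssub (s \<circ> r)"
  by (auto simp: up_ren_def up_ssub_def fun_eq_iff split: nat.split)

lemma ssub_sren: "ssub s (sren r e) = ssub (s \<circ> r) e"
  by (induction e arbitrary: s r) (simp_all add: up_ssub_up_ren)

lemma sren_up_ssub: "sren (up_ren r) \<circ> up_ssub s = up_ssub (sren r \<circ> s)"
  \<comment> \<open>\<open>up_ren_def\<close> is held back for index \<open>0\<close>: unfolded
    earlier, it would destroy the pattern of \<open>up_ren_Suc\<close>.\<close>
  by (auto simp: up_ssub_def fun_eq_iff sren_sren up_ren_Suc split: nat.split)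
    (simp add: up_ren_def)

lemma sren_ssub: "sren r (ssub s e) = ssub (sren r \<circ> s) e"
  by (induction e arbitrary: s r) (simp_all add: sren_up_ssub)

lemma up_ssub_SVar: "up_ssub SVar = SVar"
  by (auto simp: up_ssub_def fun_eq_iff split: nat.split)

lemma ssub_SVar: "ssub SVar e = e"
  by (induction e) (simp_all add: up_ssub_SVar)

lemma is_sval_sren: "is_sval (sren r e) = is_sval e"
  by (cases e) auto

lemma is_sval_ssub:
  assumes "is_sval e" and "\<And>i. is_sval (s i)"
  shows "is_sval (ssub s e)"
  using assms by (cases e) auto

lemma is_sval_up_ssub: "(\<And>i. is_sval (s i)) \<Longrightarrow> is_sval (up_ssub s i)"
  by (simp add: up_ssub_def is_sval_sren split: nat.split)

text \<open>The hole lies under no binder, so \<open>s\<close> itself acts on what fills it. This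
  companion of \<open>sctx_ren\<close> carries substitutions through
  \<open>elab_OrE\<close>.\<close>

primrec sctx_sub :: "(nat \<Rightarrow> ('n, 'o) sexp) \<Rightarrow> ('n, 'o) sctx \<Rightarrow> ('n, 'o) sctx" where
  "sctx_sub s SHole = SHole"
| "sctx_sub s (SCLet E e) = SCLet (sctx_sub s E) (ssub (up_ssub s) e)"
| "sctx_sub s (SCIf E e1 e2) = SCIf (sctx_sub s E) (ssub s e1) (ssub s e2)"
| "sctx_sub s (SCAppL E e) = SCAppL (sctx_sub s E) (ssub s e)"
| "sctx_sub s (SCAppR v E) = SCAppR (ssub s v) (sctx_sub s E)"

lemma sren_splug: "sren r (splug E e) = splug (sctx_ren r E) (sren r e)"
  by (induction E) auto

lemma ssub_splug: "ssub s (splug E e) = splug (sctx_sub s E) (ssub s e)"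
  by (induction E) auto

lemma is_sctx_sctx_ren: "is_sctx (sctx_ren r E) = is_sctx E"
  by (induction E) (auto simp: is_sval_sren)

text \<open>In \<open>SCAppR v E\<close> the operator \<open>v\<close> must stay a value, which is
  why only values are substituted.\<close>

lemma is_sctx_sctx_sub:
  assumes "is_sctx E" and "\<And>i. is_sval (s i)"
  shows "is_sctx (sctx_sub s E)"
  using assms by (induction E) (auto simp: is_sval_ssub)

lemma sctx_ren_sctx_ren: "sctx_ren r (sctx_ren q E) = sctx_ren (r \<circ> q) E"
  by (induction E arbitrary: r q) (simp_all add: sren_sren up_ren_comp)

lemma sctx_sub_sctx_ren: "sctx_sub s (sctx_ren r E) = sctx_sub (s \<circ> r) E"
  by (induction E arbitrary: s r) (simp_all add: ssub_sren up_ssub_up_ren)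

lemma sctx_ren_sctx_sub: "sctx_ren r (sctx_sub s E) = sctx_sub (sren r \<circ> s) E"
  by (induction E arbitrary: s r) (simp_all add: sren_ssub sren_up_ssub)

lemma sctx_sub_SVar: "sctx_sub SVar E = E"
  by (induction E) (simp_all add: ssub_SVar up_ssub_SVar)

text \<open>\<open>up_ren r\<close> fixes index \<open>0\<close> and passes \<open>Suc\<close> by
  \<open>up_ren_Suc\<close>, so the branch premises of \<open>elab_OrE\<close> keep their shape
  under renaming.\<close>

lemma sren_splug_SVar_0:
  "sren (up_ren r) (splug (sctx_ren Suc E) (SVar 0)) = splug (sctx_ren Suc (sctx_ren r E)) (SVar 0)"
  by (simp add: sren_splug sctx_ren_sctx_ren up_ren_Suc) (simp add: up_ren_def)

lemma ssub_splug_SVar_0: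
  "ssub (up_ssub s) (splug (sctx_ren Suc E) (SVar 0)) = splug (sctx_ren Suc (sctx_sub s E)) (SVar 0)"
  by (simp add: ssub_splug sctx_sub_sctx_ren sctx_ren_sctx_sub) (simp add: up_ssub_def comp_def)

text \<open>Lifting keeps index \<open>0\<close> out of the context, so the substitution reaches
  only the hole. Contracting a \<open>case\<close> redex therefore costs no source step.\<close>

lemma ssub1_splug_SVar_0: "ssub1 v (splug (sctx_ren Suc E) (SVar 0)) = splug E v"
  by (simp add: ssub1_def ssub_splug sctx_sub_sctx_ren comp_def sctx_sub_SVar)

section \<open>Elaboration under renaming and substitution\<close>

text \<open>An arbitrary type-preserving renaming lets the induction pass under binders; weakening
  is the instance \<open>r = Suc\<close>.\<close>

lemma elab_ren:
  assumes "elab opty \<Gamma> e A M"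
    and "\<And>i. i < length \<Gamma> \<Longrightarrow> r i < length \<Delta> \<and> \<Delta> ! r i = \<Gamma> ! i"
  shows "elab opty \<Delta> (sren r e) A (tren r M)"
  using assms
proof (induction arbitrary: \<Delta> r rule: elab.induct)
  case (elab_Let \<Gamma> e1 A1 M1 e2 A2 M2)
  have "elab opty (A1 # \<Delta>) (sren (up_ren r) e2) A2 (tren (up_ren r) M2)"
    using elab_Let.prems
    by (intro elab_Let.IH(2)) (auto simp: up_ren_def less_Suc_eq_0_disj)
  with elab_Let show ?case by (auto intro: elab.elab_Let)
next
  case (elab_Lam A B \<Gamma> e M)
  have "elab opty (A # \<Delta>) (sren (up_ren r) e) B (tren (up_ren r) M)"
    using elab_Lam.prems
    by (intro elab_Lam.IH) (auto simp: up_ren_def less_Suc_eq_0_disj)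
  with elab_Lam show ?case by (auto intro: elab.elab_Lam)
next
  case (elab_OrE E \<Gamma> e0 A1 A2 M0 B M1 M2)
  let ?E = "splug (sctx_ren Suc (sctx_ren r E)) (SVar 0)"
  have "elab opty (A1 # \<Delta>) ?E B (tren (up_ren r) M1)" "elab opty (A2 # \<Delta>) ?E B (tren (up_ren r) M2)"
    \<comment> \<open>Written as renamings of the original branch premises, the goals match the
      induction hypotheses.\<close>
    unfolding sren_splug_SVar_0[symmetric] using elab_OrE.prems
    by (auto intro!: elab_OrE.IH simp: up_ren_def less_Suc_eq_0_disj)
  with elab_OrE.hyps(1) elab_OrE.IH(1)[OF elab_OrE.prems] show ?case
    by (auto simp: sren_splug is_sctx_sctx_ren intro: elab.elab_OrE)
next
  case (elab_App \<Gamma> e1 A B M1 e2 M2)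
  from elab_App.IH[OF elab_App.prems] show ?case by (auto intro: elab.elab_App)
qed (auto intro: elab.intros simp: is_sval_sren)

text \<open>Values are demanded at every index, even outside \<open>\<Gamma>\<close>, because
  \<open>is_sctx_sctx_sub\<close> has no scoping condition on the context.\<close>

definition sub_typed where
  "sub_typed opty \<Gamma> \<Delta> s t \<longleftrightarrow> (\<forall>i. is_sval (s i)) \<and>
    (\<forall>i < length \<Gamma>. elab opty \<Delta> (s i) (\<Gamma> ! i) (t i))"

text \<open>The new variable elaborates to itself; the images of the old ones are weakened by
  \<open>elab_ren\<close>.\<close>

lemma sub_typed_up:
  "sub_typed opty \<Gamma> \<Delta> s t \<Longrightarrow> sub_typed opty (A # \<Gamma>) (A # \<Delta>) (up_ssub s) (up_tsub t)"
  unfolding sub_typed_def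
  by (auto simp: is_sval_up_ssub less_Suc_eq_0_disj)
    (auto simp: up_ssub_def up_tsub_def intro: elab_Var elab_ren)

text \<open>Two rules call for substituting values: \<open>elab_AndI\<close> needs its subject to
  remain a value, \<open>elab_OrE\<close> its context to remain an evaluation context.\<close>

lemma elab_sub:
  assumes "elab opty \<Gamma> e A M" and "sub_typed opty \<Gamma> \<Delta> s t"
  shows "elab opty \<Delta> (ssub s e) A (tsub t M)"
  using assms
proof (induction arbitrary: \<Delta> s t rule: elab.induct)
  case (elab_Var i \<Gamma> A)
  then show ?case by (auto simp: sub_typed_def)
next
  case (elab_AndI v \<Gamma> A1 M1 A2 M2)
  then show ?case by (auto simp: sub_typed_def is_sval_ssub intro: elab.elab_AndI)
next
  case (elab_Let \<Gamma> e1 A1 M1 e2 A2 M2)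
  from elab_Let.IH(1)[OF elab_Let.prems] elab_Let.IH(2)[OF sub_typed_up[OF elab_Let.prems]]
  show ?case by (auto intro: elab.elab_Let)
next
  case (elab_Lam A B \<Gamma> e M)
  then show ?case by (auto intro!: elab.elab_Lam sub_typed_up)
next
  case (elab_App \<Gamma> e1 A B M1 e2 M2)
  from elab_App.IH[OF elab_App.prems] show ?case by (auto intro: elab.elab_App)
next
  case (elab_OrE E \<Gamma> e0 A1 A2 M0 B M1 M2)
  have "is_sctx (sctx_sub s E)"
    using elab_OrE by (simp add: is_sctx_sctx_sub sub_typed_def)
  with elab_OrE.IH(1)[OF elab_OrE.prems]
    elab_OrE.IH(2,3)[OF sub_typed_up[OF elab_OrE.prems], unfolded ssub_splug_SVar_0]
  show ?case
    by (auto simp: ssub_splug intro: elab.elab_OrE)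
qed (auto intro: elab.intros)

lemma elab_sub1:
  assumes "elab opty (A # \<Gamma>) e B M" and "elab opty \<Gamma> v A W" and "is_sval v"
  shows "elab opty \<Gamma> (ssub1 v e) B (tsub1 W M)"
  unfolding ssub1_def tsub1_def
  by (rule elab_sub[OF assms(1)])
    (use assms(2,3) in \<open>auto simp: sub_typed_def less_Suc_eq_0_disj intro: elab_Var split: nat.split\<close>)

section \<open>Simulation\<close>

inductive_cases elab_TConstE: "elab opty \<Gamma> e A (TConst c)"
inductive_cases elab_TLamE: "elab opty \<Gamma> e A (TLam M)"
inductive_cases elab_TLetE: "elab opty \<Gamma> e A (TLet M1 M2)"
inductive_cases elab_TIfE: "elab opty \<Gamma> e A (TIf M M1 M2)"
inductive_cases elab_TAppE: "elab opty \<Gamma> e A (TApp M1 M2)"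
inductive_cases elab_TPairE: "elab opty \<Gamma> e A (TPair M1 M2)"
inductive_cases elab_TProj1E: "elab opty \<Gamma> e A (TProj1 M)"
inductive_cases elab_TProj2E: "elab opty \<Gamma> e A (TProj2 M)"
inductive_cases elab_TInj1E: "elab opty \<Gamma> e A (TInj1 M)"
inductive_cases elab_TInj2E: "elab opty \<Gamma> e A (TInj2 M)"
inductive_cases elab_TCaseE: "elab opty \<Gamma> e A (TCase M M1 M2)"
inductive_cases elab_TDeadE: "elab opty \<Gamma> e A (TDead B C M)"

lemma elab_tval_imp_sval: "elab opty \<Gamma> e A W \<Longrightarrow> is_tval W \<Longrightarrow> is_sval e"
  by (induction rule: elab.induct) auto

lemma ssteps_ctx:
  assumes "(sstep \<delta>)\<^sup>*\<^sup>* e e'" and "is_sctx E"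
  shows "(sstep \<delta>)\<^sup>*\<^sup>* (splug E e) (splug E e')"
  using assms by (induction rule: rtranclp_induct) (auto intro: rtranclp.rtrancl_into_rtrancl sstep_ctx)

text \<open>Quantifying over \<open>e\<close> and \<open>A\<close> makes the property usable at
  whatever source subexpression and type inversion of a frame yields.\<close>

definition simulated where
  "simulated opty \<delta>s M M' \<longleftrightarrow>
    (\<forall>e A. elab opty [] e A M \<longrightarrow> (\<exists>e'. (sstep \<delta>s)\<^sup>*\<^sup>* e e' \<and> elab opty [] e' A M'))"

lemma simulatedI:
  "(\<And>e A. elab opty [] e A M \<Longrightarrow> \<exists>e'. (sstep \<delta>s)\<^sup>*\<^sup>* e e' \<and> elab opty [] e' A M') \<Longrightarrow>
    simulated opty \<delta>s M M'"
  by (simp add: simulated_def)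

lemma simulatedD:
  assumes "simulated opty \<delta>s M M'" and "elab opty [] e A M"
  obtains e' where "(sstep \<delta>s)\<^sup>*\<^sup>* e e'" and "elab opty [] e' A M'"
  using assms by (auto simp: simulated_def)

text \<open>For \<open>let\<close>, \<open>if\<close> and application the source steps take place in
  the matching one-layer context; injections, projections and casts share their source expression
  with the subexpression; for \<open>case\<close> the steps take place in the context
  \<open>E\<close> of \<open>elab_OrE\<close>.\<close>

lemma simulated_tplug:
  assumes "simulated opty \<delta>s M M'" and "is_tctx F"
  shows "simulated opty \<delta>s (tplug F M) (tplug F M')"
  using assms(2)
proof (induction F)
  case THole
  then show ?case using assms(1) by simp
next
  case (TCLet F M2)
  show ?case
  proof (rule simulatedI)
    fix e A assume "elab opty [] e A (tplug (TCLet F M2) M)"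
    then obtain e1 e2 A1 where e: "e = SLet e1 e2" "elab opty [] e1 A1 (tplug F M)"
      "elab opty [A1] e2 A M2"
      by (auto elim: elab_TLetE)
    obtain e1' where "(sstep \<delta>s)\<^sup>*\<^sup>* e1 e1'" "elab opty [] e1' A1 (tplug F M')"
      using TCLet e(2) by (auto elim: simulatedD)
    then show "\<exists>e'. (sstep \<delta>s)\<^sup>*\<^sup>* e e' \<and> elab opty [] e' A (tplug (TCLet F M2) M')"
      using e ssteps_ctx[where E = "SCLet SHole e2"] by (fastforce intro: elab_Let)
  qed
next
  case (TCIf F M1 M2)
  show ?case
  proof (rule simulatedI)
    fix e A assume "elab opty [] e A (tplug (TCIf F M1 M2) M)"
    then obtain e0 e1 e2 where e: "e = SIf e0 e1 e2" "elab opty [] e0 (Prim Boolean) (tplug F M)"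
      "elab opty [] e1 A M1" "elab opty [] e2 A M2"
      by (auto elim: elab_TIfE)
    obtain e0' where "(sstep \<delta>s)\<^sup>*\<^sup>* e0 e0'" "elab opty [] e0' (Prim Boolean) (tplug F M')"
      using TCIf e(2) by (auto elim: simulatedD)
    then show "\<exists>e'. (sstep \<delta>s)\<^sup>*\<^sup>* e e' \<and> elab opty [] e' A (tplug (TCIf F M1 M2) M')"
      using e ssteps_ctx[where E = "SCIf SHole e1 e2"] by (fastforce intro: elab_If)
  qed
next
  case (TCAppL F M2)
  show ?case
  proof (rule simulatedI)
    fix e A assume "elab opty [] e A (tplug (TCAppL F M2) M)"
    then obtain e1 e2 B where e: "e = SApp e1 e2" "elab opty [] e1 (Arrow B A) (tplug F M)"
      "elab opty [] e2 B M2"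
      by (auto elim: elab_TAppE)
    obtain e1' where "(sstep \<delta>s)\<^sup>*\<^sup>* e1 e1'" "elab opty [] e1' (Arrow B A) (tplug F M')"
      using TCAppL e(2) by (auto elim: simulatedD)
    then show "\<exists>e'. (sstep \<delta>s)\<^sup>*\<^sup>* e e' \<and> elab opty [] e' A (tplug (TCAppL F M2) M')"
      using e ssteps_ctx[where E = "SCAppL SHole e2"] by (fastforce intro: elab_App)
  qed
next
  case (TCAppR W F)
  show ?case
  proof (rule simulatedI)
    fix e A assume "elab opty [] e A (tplug (TCAppR W F) M)"
    then obtain e1 e2 B where e: "e = SApp e1 e2" "elab opty [] e1 (Arrow B A) W"
      "elab opty [] e2 B (tplug F M)"
      by (auto elim: elab_TAppE)
    obtain e2' where "(sstep \<delta>s)\<^sup>*\<^sup>* e2 e2'" "elab opty [] e2' B (tplug F M')"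
      using TCAppR e(3) by (auto elim: simulatedD)
    \<comment> \<open>This makes \<open>SCAppR e1 SHole\<close> an evaluation context.\<close>
    moreover have "is_sval e1"
      using TCAppR e(2) by (auto intro: elab_tval_imp_sval)
    ultimately show "\<exists>e'. (sstep \<delta>s)\<^sup>*\<^sup>* e e' \<and> elab opty [] e' A (tplug (TCAppR W F) M')"
      using e ssteps_ctx[where E = "SCAppR e1 SHole"] by (fastforce intro: elab_App)
  qed
next
  case (TCInj1 F)
  then show ?case by (fastforce simp: simulated_def elim!: elab_TInj1E intro: elab_OrI1)
next
  case (TCInj2 F)
  then show ?case by (fastforce simp: simulated_def elim!: elab_TInj2E intro: elab_OrI2)
next
  case (TCProj1 F)
  then show ?case by (fastforce simp: simulated_def elim!: elab_TProj1E intro: elab_AndE1)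
next
  case (TCProj2 F)
  then show ?case by (fastforce simp: simulated_def elim!: elab_TProj2E intro: elab_AndE2)
next
  case (TCDead A B F)
  then show ?case by (fastforce simp: simulated_def elim!: elab_TDeadE intro: elab_Dead)
next
  case (TCCase F M1 M2)
  show ?case
  proof (rule simulatedI)
    fix e A assume "elab opty [] e A (tplug (TCCase F M1 M2) M)"
    then obtain E e0 A1 A2 where e: "e = splug E e0" "is_sctx E"
      "elab opty [] e0 (Or A1 A2) (tplug F M)"
      "elab opty [A1] (splug (sctx_ren Suc E) (SVar 0)) A M1"
      "elab opty [A2] (splug (sctx_ren Suc E) (SVar 0)) A M2"
      by (auto elim: elab_TCaseE)
    obtain e0' where "(sstep \<delta>s)\<^sup>*\<^sup>* e0 e0'" "elab opty [] e0' (Or A1 A2) (tplug F M')"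
      using TCCase e(3) by (auto elim: simulatedD)
    \<comment> \<open>The branch premises depend on \<open>E\<close> but not on \<open>e0\<close>,
      so they serve for \<open>e0'\<close> as well.\<close>
    then show "\<exists>e'. (sstep \<delta>s)\<^sup>*\<^sup>* e e' \<and> elab opty [] e' A (tplug (TCCase F M1 M2) M')"
      using e ssteps_ctx[where E = E] by (fastforce intro: elab_OrE)
  qed
qed

text \<open>Since \<open>e0\<close> elaborates to a target value it is a source value and may be
  substituted for the branch variable, which restores \<open>splug E e0\<close>.\<close>

lemma simulated_case:
  assumes "elab opty [A1] (splug (sctx_ren Suc E) (SVar 0)) A M1"
    and "elab opty [] e0 A1 W" and "is_tval W"
  shows "elab opty [] (splug E e0) A (tsub1 W M1)"
  using elab_sub1[OF assms(1,2)] elab_tval_imp_sval[OF assms(2,3)]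
  by (simp add: ssub1_splug_SVar_0)

lemma tstep_simulated:
  assumes "prim_app opty \<delta>s \<delta>t" and "tstep \<delta>t M M'"
  shows "simulated opty \<delta>s M M'"
  using assms(2)
proof (induction rule: tstep.induct)
  case (tstep_ctx F M M')
  then show ?case by (simp add: simulated_tplug)
next
  case (tstep_prim W c M)
  show ?case
  proof (rule simulatedI)
    fix e A assume "elab opty [] e A (TApp (TConst c) W)"
    then obtain e1 v B where "e = SApp e1 v" and e1: "elab opty [] e1 (Arrow B A) (TConst c)"
      and "elab opty [] v B W"
      by (auto elim: elab_TAppE)
    moreover from e1 have "e1 = SConst c" by (auto elim: elab_TConstE)
    ultimately have e: "e = SApp (SConst c) v" "elab opty [] (SConst c) (Arrow B A) (TConst c)"
      "elab opty [] v B W"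
      by simp_all
    \<comment> \<open>The target step rules out every DEAD cast, in particular those into
      \<open>B\<close> that \<open>prim_app\<close> excludes.\<close>
    with tstep_prim have "is_sval v" "\<nexists>C N. W = TDead C B N"
      by (auto intro: elab_tval_imp_sval)
    with assms(1) e tstep_prim obtain e' N where "\<delta>t c W = Some N"
      "sstep \<delta>s (SApp (SConst c) v) e'" "elab opty [] e' A N"
      unfolding prim_app_def by blast
    \<comment> \<open>\<open>M\<close> and \<open>N\<close> are both the result of
      \<open>\<delta>t c W\<close>, hence equal.\<close>
    with e tstep_prim show "\<exists>e'. (sstep \<delta>s)\<^sup>*\<^sup>* e e' \<and> elab opty [] e' A M" by auto
  qed
next
  case (tstep_beta W M)
  show ?case
  proof (rule simulatedI)
    fix e A assume "elab opty [] e A (TApp (TLam M) W)"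
    then obtain e1 v B where e: "e = SApp (SLam e1) v" "elab opty [B] e1 A M" "elab opty [] v B W"
      by (auto elim!: elab_TAppE elab_TLamE)
    with tstep_beta have "is_sval v" by (auto intro: elab_tval_imp_sval)
    with e show "\<exists>e'. (sstep \<delta>s)\<^sup>*\<^sup>* e e' \<and> elab opty [] e' A (tsub1 W M)"
      by (auto intro: elab_sub1 sstep_beta)
  qed
next
  case (tstep_if_true M1 M2)
  show ?case
  proof (rule simulatedI)
    fix e A assume "elab opty [] e A (TIf (TConst (Bool True)) M1 M2)"
    then show "\<exists>e'. (sstep \<delta>s)\<^sup>*\<^sup>* e e' \<and> elab opty [] e' A M1"
      by (auto elim!: elab_TIfE elab_TConstE intro: sstep_if_true)
  qed
next
  case (tstep_if_false M1 M2)
  show ?case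
  proof (rule simulatedI)
    fix e A assume "elab opty [] e A (TIf (TConst (Bool False)) M1 M2)"
    then show "\<exists>e'. (sstep \<delta>s)\<^sup>*\<^sup>* e e' \<and> elab opty [] e' A M2"
      by (auto elim!: elab_TIfE elab_TConstE intro: sstep_if_false)
  qed
next
  case (tstep_let W M)
  show ?case
  proof (rule simulatedI)
    fix e A assume "elab opty [] e A (TLet W M)"
    then obtain v e2 B where e: "e = SLet v e2" "elab opty [B] e2 A M" "elab opty [] v B W"
      by (auto elim!: elab_TLetE)
    with tstep_let have "is_sval v" by (auto intro: elab_tval_imp_sval)
    with e show "\<exists>e'. (sstep \<delta>s)\<^sup>*\<^sup>* e e' \<and> elab opty [] e' A (tsub1 W M)"
      by (auto intro: elab_sub1 sstep_let)
  qed
next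
  case (tstep_proj1 M1 M2)
  show ?case
    \<comment> \<open>Both components of the pair elaborate the same source value, so
      \<open>e' = e\<close> works.\<close>
    by (rule simulatedI) (auto elim!: elab_TProj1E elab_TPairE)
next
  case (tstep_proj2 M1 M2)
  show ?case
    by (rule simulatedI) (auto elim!: elab_TProj2E elab_TPairE)
next
  case (tstep_case1 W M1 M2)
  then show ?case
    by (intro simulatedI) (auto elim!: elab_TCaseE elab_TInj1E intro: simulated_case)
next
  case (tstep_case2 W M1 M2)
  then show ?case
    by (intro simulatedI) (auto elim!: elab_TCaseE elab_TInj2E intro: simulated_case)
qed

theorem theorem4:
  fixes opty :: "'o \<Rightarrow> ty"
    and \<delta>s :: "('n, 'o) const \<Rightarrow> ('n, 'o) sexp \<rightharpoonup> ('n, 'o) sexp"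
    and \<delta>t :: "('n, 'o) const \<Rightarrow> ('n, 'o) texp \<rightharpoonup> ('n, 'o) texp"
    and e :: "('n, 'o) sexp" and A :: ty and M M' :: "('n, 'o) texp"
  assumes "prim_app opty \<delta>s \<delta>t"
    and "elab opty [] e A M"
    and "tstep \<delta>t M M'"
  shows "\<exists>e'. (sstep \<delta>s)\<^sup>*\<^sup>* e e' \<and> elab opty [] e' A M'"
  using tstep_simulated[OF assms(1,3)] assms(2) by (simp add: simulated_def)

end
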